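(* Let $\Delta\geq 2$ be an integer and $0<\varepsilon<1/2$. If $c\geq (30\Delta/\varepsilon)\log(4e/\varepsilon)$, then with probability tending to $1$ as $n\to\infty$ the random graph $\mathcal{G}(n,c/n)$ contains a copy of every tree on at most $(1-\varepsilon)n$ vertices with maximum degree at most $\Delta$.
   Context: $\mathcal{G}(n,p)$ is the random graph on $n$ vertices in which each edge is present independently with probability $p$; $\log$ is the natural logarithm. *)

theory Defs
  imports "HOL-Probability.Probability" "HOL-Probability.Product_PMF" "HOL-Library.Ramsey"
begin

text \<open>Undirected graphs are pairs of a vertex set and a set of edges, an edge being a set of
  two vertices.  (The notion of tree in the digraph library is unsuitable for symmetric digraphs:
  there the walk \<open>a, b, a\<close> along an edge counts as a cycle.)\<close>

type_synonym 'a ugraph = "'a set \<times> 'a set set"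

abbreviation uverts :: "'a ugraph \<Rightarrow> 'a set" where
  "uverts G \<equiv> fst G"

abbreviation uedges :: "'a ugraph \<Rightarrow> 'a set set" where
  "uedges G \<equiv> snd G"

definition simple_graph :: "'a ugraph \<Rightarrow> bool" where
  "simple_graph G \<longleftrightarrow> finite (uverts G) \<and> uedges G \<subseteq> nsets (uverts G) 2"

definition ugraph_walk :: "'a ugraph \<Rightarrow> 'a list \<Rightarrow> bool" where
  "ugraph_walk G xs \<longleftrightarrow>
     xs \<noteq> [] \<and> set xs \<subseteq> uverts G \<and> successively (\<lambda>u v. {u, v} \<in> uedges G) xs"

definition ugraph_connected :: "'a ugraph \<Rightarrow> bool" where
  "ugraph_connected G \<longleftrightarrow> uverts G \<noteq> {} \<and>
     (\<forall>u\<in>uverts G. \<forall>v\<in>uverts G. \<exists>xs. ugraph_walk G xs \<and> hd xs = u \<and> last xs = v)"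

text \<open>A cycle is given by the list of its vertices, without repeating the first one at the end.\<close>

definition ugraph_cycle :: "'a ugraph \<Rightarrow> 'a list \<Rightarrow> bool" where
  "ugraph_cycle G xs \<longleftrightarrow>
     ugraph_walk G xs \<and> distinct xs \<and> length xs \<ge> 3 \<and> {last xs, hd xs} \<in> uedges G"

definition ugraph_tree :: "'a ugraph \<Rightarrow> bool" where
  "ugraph_tree G \<longleftrightarrow> simple_graph G \<and> ugraph_connected G \<and> (\<nexists>xs. ugraph_cycle G xs)"

definition ugraph_degree :: "'a ugraph \<Rightarrow> 'a \<Rightarrow> nat" where
  "ugraph_degree G v = card {e \<in> uedges G. v \<in> e}"

text \<open>Only meaningful for finite graphs with at least one vertex.\<close>

definition ugraph_max_degree :: "'a ugraph \<Rightarrow> nat" where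
  "ugraph_max_degree G = Max (ugraph_degree G ` uverts G)"

definition ugraph_subgraph :: "'a ugraph \<Rightarrow> 'a ugraph \<Rightarrow> bool" where
  "ugraph_subgraph H G \<longleftrightarrow>
     simple_graph H \<and> uverts H \<subseteq> uverts G \<and> uedges H \<subseteq> uedges G"

definition ugraph_isomorphic :: "'a ugraph \<Rightarrow> 'b ugraph \<Rightarrow> bool" where
  "ugraph_isomorphic G H \<longleftrightarrow> (\<exists>f. bij_betw f (uverts G) (uverts H) \<and>
     (\<forall>u\<in>uverts G. \<forall>v\<in>uverts G. {u, v} \<in> uedges G \<longleftrightarrow> {f u, f v} \<in> uedges H))"

definition contains_copy :: "'a ugraph \<Rightarrow> 'b ugraph \<Rightarrow> bool" where
  "contains_copy G T \<longleftrightarrow> (\<exists>H. ugraph_subgraph H G \<and> ugraph_isomorphic T H)"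

text \<open>The binomial random graph on the vertex set \<open>{0, \<dots>, n - 1}\<close>: one independent Bernoulli
  variable for each pair of vertices.  If \<open>p\<close> is outside the unit interval,
  \<^const>\<open>bernoulli_pmf\<close> truncates it to that interval; for \<open>p = c / n\<close> with fixed \<open>c > 0\<close>
  this concerns only finitely many \<open>n\<close>.\<close>

definition gnp :: "nat \<Rightarrow> real \<Rightarrow> nat ugraph pmf" where
  "gnp n p = map_pmf (\<lambda>X. ({..<n}, {e \<in> nsets {..<n} 2. X e}))
     (Pi_pmf (nsets {..<n} 2) False (\<lambda>_. bernoulli_pmf p))"

end

theory Submission
  imports Defs "HOL-Real_Asymp.Real_Asymp"
begin

text \<open>A graph in which any two disjoint vertex sets of sizes \<open>m\<close> and \<open>b\<close> are joined by an edge
  becomes an expander once a maximum non-expanding set (of fewer than \<open>m\<close> vertices) is deleted. In an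
  expander every bounded degree tree can be grown leaf by leaf, by the method of Friedman, Pippenger
  and Haxell: one keeps the invariant that each set of at most \<open>m\<close> vertices has enough unoccupied
  neighbours to accommodate all the tree neighbours that its members may still need. For \<open>m = \<epsilon> n / (7 \<Delta>)\<close> and
  \<open>b = \<epsilon> n / 2\<close> this reaches \<open>(1 - \<epsilon>) n\<close> vertices, and a union bound over all pairs of sets shows
  that the random graph satisfies the hypothesis with high probability.\<close>

section \<open>Neighbourhoods and induced subgraphs\<close>

definition neighbours :: "'a ugraph \<Rightarrow> 'a \<Rightarrow> 'a set" where
  "neighbours G x = {y \<in> uverts G. {x, y} \<in> uedges G}"

definition neighbourhood :: "'a ugraph \<Rightarrow> 'a set \<Rightarrow> 'a set" where
  "neighbourhood G X = (\<Union>x\<in>X. neighbours G x)"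

definition induced_subgraph :: "'a ugraph \<Rightarrow> 'a set \<Rightarrow> 'a ugraph" where
  "induced_subgraph G U = (U, {e \<in> uedges G. e \<subseteq> U})"

lemma neighbours_commute:
  "x \<in> uverts G \<Longrightarrow> y \<in> uverts G \<Longrightarrow> y \<in> neighbours G x \<longleftrightarrow> x \<in> neighbours G y"
  by (simp add: neighbours_def insert_commute)

lemma neighbours_simple_graphD:
  assumes "simple_graph G" "y \<in> neighbours G x"
  shows "x \<in> uverts G" "y \<in> uverts G" "x \<noteq> y"
proof -
  have "{x, y} \<in> nsets (uverts G) 2"
    using assms unfolding simple_graph_def neighbours_def by blast
  then show "x \<in> uverts G" "y \<in> uverts G" "x \<noteq> y" by auto
qed

lemma neighbourhood_subset: "neighbourhood G X \<subseteq> uverts G"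
  by (auto simp: neighbourhood_def neighbours_def)

lemma finite_neighbourhood: "finite (uverts G) \<Longrightarrow> finite (neighbourhood G X)"
  by (rule finite_subset[OF neighbourhood_subset])

lemma neighbourhood_Un: "neighbourhood G (X \<union> Y) = neighbourhood G X \<union> neighbourhood G Y"
  by (simp add: neighbourhood_def)

lemma neighbourhood_mono: "X \<subseteq> Y \<Longrightarrow> neighbourhood G X \<subseteq> neighbourhood G Y"
  by (auto simp: neighbourhood_def)

lemma uverts_induced_subgraph [simp]: "uverts (induced_subgraph G U) = U"
  by (simp add: induced_subgraph_def)

lemma uedges_induced_subgraph: "uedges (induced_subgraph G U) \<subseteq> uedges G"
  by (auto simp: induced_subgraph_def)

lemma neighbourhood_induced_subgraph:
  assumes "X \<subseteq> U" "U \<subseteq> uverts G"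
  shows "neighbourhood (induced_subgraph G U) X = neighbourhood G X \<inter> U"
  using assms by (auto simp: neighbourhood_def neighbours_def induced_subgraph_def)

lemma card_neighbours_eq_degree:
  assumes "simple_graph G"
  shows "card (neighbours G v) = ugraph_degree G v"
proof -
  have edges: "(\<lambda>u. {v, u}) ` neighbours G v = {e \<in> uedges G. v \<in> e}"
  proof
    show "{e \<in> uedges G. v \<in> e} \<subseteq> (\<lambda>u. {v, u}) ` neighbours G v"
    proof
      fix e assume e: "e \<in> {e \<in> uedges G. v \<in> e}"
      then have "e \<in> nsets (uverts G) 2" using assms by (auto simp: simple_graph_def)
      then obtain x y where "e = {x, y}" "x \<in> uverts G" "y \<in> uverts G"
        by (auto simp: nsets_2_eq)
      with e show "e \<in> (\<lambda>u. {v, u}) ` neighbours G v"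
        by (auto simp: neighbours_def insert_commute)
    qed
  qed (auto simp: neighbours_def)
  have "inj_on (\<lambda>u. {v, u}) (neighbours G v)"
    by (auto simp: inj_on_def doubleton_eq_iff)
  then show ?thesis
    unfolding ugraph_degree_def edges[symmetric] by (rule card_image[symmetric])
qed

lemma card_neighbours_le_max_degree:
  assumes "simple_graph G" "v \<in> uverts G"
  shows "card (neighbours G v) \<le> ugraph_max_degree G"
  using assms by (simp add: card_neighbours_eq_degree ugraph_max_degree_def simple_graph_def)

lemma contains_copyI:
  assumes T: "simple_graph T" and inj: "inj_on f (uverts T)" and "f ` uverts T \<subseteq> uverts G"
    and hom: "\<And>u v. v \<in> neighbours T u \<Longrightarrow> f v \<in> neighbours G (f u)"
  shows "contains_copy G T"
proof -
  let ?H = "(f ` uverts T, (`) f ` uedges T)"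
  have edge: "\<exists>u v. e = {u, v} \<and> u \<in> uverts T \<and> v \<in> neighbours T u \<and> u \<noteq> v" if "e \<in> uedges T" for e
  proof -
    have "e \<in> nsets (uverts T) 2" using T that by (auto simp: simple_graph_def)
    with that show ?thesis by (auto simp: nsets_2_eq neighbours_def)
  qed
  have "f ` e \<in> nsets (f ` uverts T) 2" if "e \<in> uedges T" for e
    using edge[OF that] inj by (auto simp: neighbours_def inj_on_def)
  then have "simple_graph ?H"
    using T by (auto simp: simple_graph_def)
  moreover have "f ` e \<in> uedges G" if "e \<in> uedges T" for e
    using edge[OF that] hom by (auto simp: neighbours_def)
  ultimately have "ugraph_subgraph ?H G"
    using assms(3) by (auto simp: ugraph_subgraph_def)
  moreover have "{u, v} \<in> uedges T \<longleftrightarrow> {f u, f v} \<in> uedges ?H"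
    if uv: "u \<in> uverts T" "v \<in> uverts T" for u v
  proof
    assume "{f u, f v} \<in> uedges ?H"
    then obtain e where e: "e \<in> uedges T" "f ` e = f ` {u, v}" by auto
    moreover have "e \<subseteq> uverts T" using edge[OF e(1)] by (auto simp: neighbours_def)
    ultimately have "e = {u, v}" using inj_on_image_eq_iff[OF inj, of e "{u, v}"] uv by simp
    with e show "{u, v} \<in> uedges T" by simp
  qed (auto intro!: image_eqI[of _ _ "{u, v}"])
  then have "ugraph_isomorphic T ?H"
    using inj by (auto simp: ugraph_isomorphic_def bij_betw_def intro!: exI[of _ f])
  ultimately show ?thesis by (auto simp: contains_copy_def)
qed

lemma contains_copy_mono:
  assumes "contains_copy G T" "uverts G \<subseteq> uverts G'" "uedges G \<subseteq> uedges G'"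
  shows "contains_copy G' T"
  using assms by (fastforce simp: contains_copy_def ugraph_subgraph_def)

section \<open>Growing trees leaf by leaf\<close>

lemma successively_exit:
  assumes "successively P xs" "xs \<noteq> []" "hd xs \<in> S" "last xs \<notin> S"
  obtains u v where "u \<in> set xs \<inter> S" "v \<in> set xs - S" "P u v"
  using assms
proof (induction xs arbitrary: thesis)
  case (Cons x xs)
  have "xs \<noteq> []" using Cons.prems by auto
  then have xs: "P x (hd xs)" "successively P xs" "last xs \<notin> S"
    using Cons.prems by (auto simp: successively_Cons)
  show ?case
  proof (cases "hd xs \<in> S")
    case True
    show ?thesis
      using Cons.prems(1) by (rule Cons.IH[OF _ xs(2) \<open>xs \<noteq> []\<close> True xs(3)]) auto
  next
    case False
    then show ?thesis
      using Cons.prems xs \<open>xs \<noteq> []\<close> by (intro Cons.prems(1)[of x "hd xs"]) auto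
  qed
qed simp

lemma ugraph_connected_exit:
  assumes "ugraph_connected G" "S \<subseteq> uverts G" "S \<noteq> {}" "S \<noteq> uverts G"
  obtains s w where "s \<in> S" "w \<in> uverts G - S" "w \<in> neighbours G s"
proof -
  obtain a b where ab: "a \<in> S" "b \<in> uverts G - S" using assms by blast
  then obtain xs where xs: "ugraph_walk G xs" "hd xs = a" "last xs = b"
    using assms(1,2) unfolding ugraph_connected_def by blast
  then obtain u v where "u \<in> set xs \<inter> S" "v \<in> set xs - S" "{u, v} \<in> uedges G"
    using ab by (auto simp: ugraph_walk_def elim: successively_exit)
  then show thesis
    using that xs(1) by (auto simp: ugraph_walk_def neighbours_def)
qed

lemma ugraph_connected_distinct_walk:
  assumes "ugraph_connected G" "u \<in> uverts G" "v \<in> uverts G"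
  obtains xs where "ugraph_walk G xs" "distinct xs" "hd xs = u" "last xs = v"
proof -
  let ?joins = "\<lambda>xs. ugraph_walk G xs \<and> hd xs = u \<and> last xs = v"
  obtain zs where "?joins zs" using assms by (auto simp: ugraph_connected_def)
  then obtain xs where xs: "?joins xs" and shortest: "\<And>ys. ?joins ys \<Longrightarrow> length xs \<le> length ys"
    using ex_has_least_nat[of ?joins zs length] by blast
  have "distinct xs"
  proof (rule ccontr)
    assume "\<not> distinct xs"
    then obtain as bs cs x where eq: "xs = as @ [x] @ bs @ [x] @ cs"
      using not_distinct_decomp by blast
    have "?joins (as @ [x] @ cs)"
      using xs unfolding eq ugraph_walk_def
      by (auto simp: successively_append_iff successively_Cons hd_append)
    from shortest[OF this] show False by (simp add: eq)
  qed
  with xs that show thesis by blast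
qed

lemma ugraph_walk_rev: "ugraph_walk G (rev xs) \<longleftrightarrow> ugraph_walk G xs"
  by (simp add: ugraph_walk_def insert_commute)

lemma ugraph_walk_append:
  assumes "ugraph_walk G xs" "ugraph_walk G ys" "last xs = hd ys"
  shows "ugraph_walk G (xs @ tl ys)"
  using assms by (cases ys) (auto simp: ugraph_walk_def successively_append_iff successively_Cons)

lemma ugraph_connected_rootI:
  assumes "r \<in> uverts G"
    and reach: "\<And>v. v \<in> uverts G \<Longrightarrow> \<exists>xs. ugraph_walk G xs \<and> hd xs = r \<and> last xs = v"
  shows "ugraph_connected G"
  unfolding ugraph_connected_def
proof (intro conjI ballI)
  fix u v assume "u \<in> uverts G" "v \<in> uverts G"
  then obtain xs ys where xs: "ugraph_walk G xs" "hd xs = r" "last xs = u"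
    and ys: "ugraph_walk G ys" "hd ys = r" "last ys = v"
    using reach by meson
  have "ugraph_walk G (rev xs @ tl ys)"
    using xs ys by (intro ugraph_walk_append) (simp_all add: ugraph_walk_rev last_rev)
  moreover have "hd (rev xs @ tl ys) = u" "last (rev xs @ tl ys) = v"
    using xs ys by (cases ys; auto simp: ugraph_walk_def hd_rev last_rev)+
  ultimately show "\<exists>zs. ugraph_walk G zs \<and> hd zs = u \<and> last zs = v" by blast
qed (use assms(1) in blast)

lemma ugraph_walk_induced_subgraph:
  assumes "S \<subseteq> uverts G"
  shows "ugraph_walk (induced_subgraph G S) xs \<longleftrightarrow> ugraph_walk G xs \<and> set xs \<subseteq> S"
proof (cases "set xs \<subseteq> S")
  case True
  then have "successively (\<lambda>u v. {u, v} \<in> uedges (induced_subgraph G S)) xs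
      \<longleftrightarrow> successively (\<lambda>u v. {u, v} \<in> uedges G) xs"
    by (intro successively_cong) (auto simp: induced_subgraph_def)
  with True assms show ?thesis by (auto simp: ugraph_walk_def)
qed (simp add: ugraph_walk_def)

lemma ugraph_connected_induced_insert:
  assumes conn: "ugraph_connected (induced_subgraph G S)"
    and "S \<subseteq> uverts G" "s \<in> S" "w \<in> neighbours G s"
  shows "ugraph_connected (induced_subgraph G (insert w S))"
proof (rule ugraph_connected_rootI)
  fix v assume v: "v \<in> uverts (induced_subgraph G (insert w S))"
  have sub: "insert w S \<subseteq> uverts G" using assms by (auto simp: neighbours_def)
  show "\<exists>xs. ugraph_walk (induced_subgraph G (insert w S)) xs \<and> hd xs = s \<and> last xs = v"
  proof (cases "v = w")
    case True
    have "ugraph_walk (induced_subgraph G (insert w S)) [s, w]"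
      unfolding ugraph_walk_induced_subgraph[OF sub]
      using assms sub by (auto simp: ugraph_walk_def neighbours_def)
    with True show ?thesis by (intro exI[of _ "[s, w]"]) simp
  next
    case False
    then obtain xs where "ugraph_walk (induced_subgraph G S) xs" "hd xs = s" "last xs = v"
      using conn \<open>s \<in> S\<close> v by (auto simp: ugraph_connected_def)
    then show ?thesis
      using assms(2) by (auto simp: ugraph_walk_induced_subgraph[OF sub] ugraph_walk_induced_subgraph)
  qed
qed (use assms in simp)

lemma ugraph_tree_unique_attachment:
  assumes tree: "ugraph_tree T" and "S \<subseteq> uverts T" and conn: "ugraph_connected (induced_subgraph T S)"
    and w: "w \<in> uverts T - S" and s: "s \<in> neighbours T w \<inter> S"
  shows "neighbours T w \<inter> S = {s}"
proof (rule ccontr)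
  assume "neighbours T w \<inter> S \<noteq> {s}"
  then obtain s' where s': "s' \<in> neighbours T w \<inter> S" "s' \<noteq> s" using s by blast
  obtain xs where "ugraph_walk (induced_subgraph T S) xs" "distinct xs" "hd xs = s" "last xs = s'"
    using ugraph_connected_distinct_walk[OF conn, of s s'] s s' by auto
  then have xs: "ugraph_walk T xs" "set xs \<subseteq> S" "distinct xs" "hd xs = s" "last xs = s'"
    using assms(2) by (simp_all add: ugraph_walk_induced_subgraph)
  obtain x y ys where "xs = x # y # ys"
    using xs s' by (cases xs; cases "tl xs") (auto simp: ugraph_walk_def)
  then have "ugraph_cycle T (w # xs)"
    using xs w s s' by (auto simp: ugraph_cycle_def ugraph_walk_def neighbours_def insert_commute)
  with tree show False by (auto simp: ugraph_tree_def)
qed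

lemma ugraph_tree_attach_induct [consumes 1, case_names vertex attach]:
  assumes tree: "ugraph_tree T"
    and vertex: "\<And>r. r \<in> uverts T \<Longrightarrow> P {r}"
    and attach: "\<And>S s w. S \<subset> uverts T \<Longrightarrow> w \<in> uverts T - S \<Longrightarrow> neighbours T w \<inter> S = {s} \<Longrightarrow>
      P S \<Longrightarrow> P (insert w S)"
  shows "P (uverts T)"
proof -
  define \<S> where "\<S> = {S. S \<subseteq> uverts T \<and> ugraph_connected (induced_subgraph T S) \<and> P S}"
  have T: "finite (uverts T)" "ugraph_connected T"
    using tree by (auto simp: ugraph_tree_def simple_graph_def)
  then obtain r where r: "r \<in> uverts T" by (auto simp: ugraph_connected_def)
  have "ugraph_connected (induced_subgraph T {r})"
    by (rule ugraph_connected_rootI[of r]) (auto simp: ugraph_walk_def intro!: exI[of _ "[r]"])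
  then have "{r} \<in> \<S>" using r vertex by (simp add: \<S>_def)
  moreover have "finite \<S>" using T by (simp add: \<S>_def)
  ultimately obtain S where "S \<in> \<S>" and maximal: "\<And>S'. S' \<in> \<S> \<Longrightarrow> S \<subseteq> S' \<Longrightarrow> S = S'"
    using finite_has_maximal[of \<S>] by blast
  then have S: "S \<subseteq> uverts T" "ugraph_connected (induced_subgraph T S)" "P S" "S \<noteq> {}"
    by (auto simp: \<S>_def ugraph_connected_def)
  have "S = uverts T"
  proof (rule ccontr)
    assume proper: "S \<noteq> uverts T"
    then obtain s w where sw: "s \<in> S" "w \<in> uverts T - S" "w \<in> neighbours T s"
      using ugraph_connected_exit[OF T(2) S(1,4)] by blast
    then have "s \<in> neighbours T w \<inter> S"
      using S(1) neighbours_commute[of s T w] by blast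
    then have "neighbours T w \<inter> S = {s}"
      by (rule ugraph_tree_unique_attachment[OF tree S(1,2) sw(2)])
    then have "P (insert w S)" using S proper sw by (intro attach) auto
    then have "insert w S \<in> \<S>"
      using S sw ugraph_connected_induced_insert[OF S(2,1) sw(1,3)] by (simp add: \<S>_def)
    with maximal sw show False by blast
  qed
  with S show ?thesis by simp
qed

section \<open>Embedding trees in expanders\<close>

text \<open>The room a set \<open>X\<close> leaves for continuing an embedding that occupies the vertices \<open>W\<close>, when each
  vertex \<open>x\<close> still demands \<open>r x\<close> unoccupied neighbours.\<close>

definition embedding_slack :: "'a ugraph \<Rightarrow> 'a set \<Rightarrow> ('a \<Rightarrow> int) \<Rightarrow> 'a set \<Rightarrow> int" where
  "embedding_slack G W r X = int (card (neighbourhood G X - W)) - sum r X"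

definition accommodates :: "nat \<Rightarrow> 'a ugraph \<Rightarrow> 'a set \<Rightarrow> ('a \<Rightarrow> int) \<Rightarrow> bool" where
  "accommodates m G W r \<longleftrightarrow> (\<forall>X \<subseteq> uverts G. card X \<le> m \<longrightarrow> 0 \<le> embedding_slack G W r X)"

definition tight :: "nat \<Rightarrow> 'a ugraph \<Rightarrow> 'a set \<Rightarrow> ('a \<Rightarrow> int) \<Rightarrow> 'a set \<Rightarrow> bool" where
  "tight m G W r X \<longleftrightarrow> X \<subseteq> uverts G \<and> card X \<le> m \<and> embedding_slack G W r X = 0"

definition expander :: "nat \<Rightarrow> nat \<Rightarrow> nat \<Rightarrow> 'a ugraph \<Rightarrow> bool" where
  "expander D m M G \<longleftrightarrow> finite (uverts G) \<and> uverts G \<noteq> {} \<and>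
     (\<forall>X \<subseteq> uverts G. X \<noteq> {} \<and> card X \<le> m \<longrightarrow> D * card X < card (neighbourhood G X)) \<and>
     (\<forall>X \<subseteq> uverts G. m < card X \<and> card X \<le> 2 * m \<longrightarrow> D * card X + M \<le> card (neighbourhood G X))"

lemma embedding_slack_submodular:
  assumes "finite (uverts G)" "finite A" "finite B"
  shows "embedding_slack G W r (A \<union> B) + embedding_slack G W r (A \<inter> B)
           \<le> embedding_slack G W r A + embedding_slack G W r B"
proof -
  let ?new = "\<lambda>X. neighbourhood G X - W"
  have fin: "finite (?new X)" for X using assms(1) by (simp add: finite_neighbourhood)
  have "card (?new (A \<union> B)) + card (?new (A \<inter> B)) \<le> card (?new A \<union> ?new B) + card (?new A \<inter> ?new B)"
    using fin by (intro add_mono card_mono) (auto simp: neighbourhood_def)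
  also have "\<dots> = card (?new A) + card (?new B)" using card_Un_Int[OF fin fin] by simp
  finally show ?thesis
    unfolding embedding_slack_def using sum.union_inter[OF assms(2,3), of r] by linarith
qed

lemma embedding_slack_antimono:
  assumes "\<And>x. x \<in> X \<Longrightarrow> r' x \<le> r x"
  shows "embedding_slack G W r X \<le> embedding_slack G W r' X"
  using sum_mono[of X r' r, OF assms] by (simp add: embedding_slack_def)

lemma accommodatesD:
  "accommodates m G W r \<Longrightarrow> X \<subseteq> uverts G \<Longrightarrow> card X \<le> m \<Longrightarrow> 0 \<le> embedding_slack G W r X"
  by (simp add: accommodates_def)

lemma accommodates_antimono:
  assumes "accommodates m G W r" "\<And>x. r' x \<le> r x"
  shows "accommodates m G W r'"
  using assms unfolding accommodates_def by (meson embedding_slack_antimono order.trans)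

lemma embedding_slack_occupy:
  assumes "finite (uverts G)" "finite X" "y \<notin> W"
  shows "embedding_slack G (insert y W) (r(s := r s - 1)) X
           = embedding_slack G W r X - of_bool (y \<in> neighbourhood G X) + of_bool (s \<in> X)"
proof -
  let ?new = "neighbourhood G X - W"
  have "finite ?new" using assms by (simp add: finite_neighbourhood)
  then have "int (card (neighbourhood G X - insert y W))
      = int (card ?new) - of_bool (y \<in> neighbourhood G X)"
    using assms(3) card_Suc_Diff1[of ?new y]
    by (subst Diff_insert) (cases "y \<in> ?new"; auto)
  moreover have "sum (r(s := r s - 1)) X = (\<Sum>x\<in>X. r x - of_bool (x = s))"
    by (intro sum.cong) auto
  moreover have "\<dots> = sum r X - of_bool (s \<in> X)"
    using assms(2) by (simp add: sum_subtractf of_bool_def)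
  ultimately show ?thesis by (simp only: embedding_slack_def)
qed

lemma expander_embedding_slack_pos:
  assumes G: "expander D m M G" and W: "finite W" "card W < M" and r: "\<And>x. r x \<le> int D"
    and X: "X \<subseteq> uverts G" "m < card X" "card X \<le> 2 * m"
  shows "0 < embedding_slack G W r X"
proof -
  have "D * card X + M \<le> card (neighbourhood G X)" using G X by (simp add: expander_def)
  also have "\<dots> \<le> card (neighbourhood G X - W) + card W"
    using diff_card_le_card_Diff[OF W(1), of "neighbourhood G X"] by linarith
  finally have "card X * D < card (neighbourhood G X - W)"
    using W(2) by (simp add: mult.commute)
  then have "int (card X) * int D < int (card (neighbourhood G X - W))"
    by (metis of_nat_less_iff of_nat_mult)
  moreover have "sum r X \<le> int (card X) * int D" by (intro sum_bounded_above r)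
  ultimately show ?thesis by (simp add: embedding_slack_def)
qed

lemma tight_Un:
  assumes fin: "finite (uverts G)" and room: "accommodates m G W r"
    and large: "\<And>X. X \<subseteq> uverts G \<Longrightarrow> m < card X \<Longrightarrow> card X \<le> 2 * m \<Longrightarrow> 0 < embedding_slack G W r X"
    and "tight m G W r A" "tight m G W r B"
  shows "tight m G W r (A \<union> B)"
proof -
  have AB: "A \<subseteq> uverts G" "B \<subseteq> uverts G" "card A \<le> m" "card B \<le> m"
    "embedding_slack G W r A = 0" "embedding_slack G W r B = 0" "finite A" "finite B"
    using assms by (auto simp: tight_def intro: finite_subset)
  have "card (A \<inter> B) \<le> card A" using AB by (intro card_mono) auto
  then have "0 \<le> embedding_slack G W r (A \<inter> B)"
    using AB by (intro accommodatesD[OF room]) auto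
  then have nonpos: "embedding_slack G W r (A \<union> B) \<le> 0"
    using embedding_slack_submodular[OF fin AB(7,8), of W r] AB by linarith
  moreover have "card (A \<union> B) \<le> 2 * m" using card_Un_le[of A B] AB by linarith
  ultimately have "card (A \<union> B) \<le> m"
    using large[of "A \<union> B"] AB by fastforce
  with nonpos show ?thesis
    using AB accommodatesD[OF room, of "A \<union> B"] by (simp add: tight_def)
qed

lemma tight_UN:
  assumes "finite (uverts G)" "accommodates m G W r"
    and "\<And>X. X \<subseteq> uverts G \<Longrightarrow> m < card X \<Longrightarrow> card X \<le> 2 * m \<Longrightarrow> 0 < embedding_slack G W r X"
    and "finite I" "\<And>i. i \<in> I \<Longrightarrow> tight m G W r (A i)"
  shows "tight m G W r (\<Union>i\<in>I. A i)"
  using assms(4,5)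
proof (induction I rule: finite_induct)
  case empty
  show ?case by (simp add: tight_def embedding_slack_def neighbourhood_def)
next
  case (insert i I)
  then show ?case using tight_Un[OF assms(1-3), of "A i" "\<Union>i\<in>I. A i"] by simp
qed

lemma tight_blocking_set:
  assumes fin: "finite (uverts G)" and room: "accommodates m G W r" and "y \<notin> W"
    and blocked: "\<not> accommodates m G (insert y W) (r(s := r s - 1))"
  obtains X where "tight m G W r X" "y \<in> neighbourhood G X" "s \<notin> X"
proof -
  obtain X where X: "X \<subseteq> uverts G" "card X \<le> m"
    and neg: "embedding_slack G (insert y W) (r(s := r s - 1)) X < 0"
    using blocked by (auto simp: accommodates_def not_le)
  have "finite X" using X(1) fin by (rule finite_subset)
  then have "embedding_slack G W r X - of_bool (y \<in> neighbourhood G X) + of_bool (s \<in> X) < 0"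
    using neg embedding_slack_occupy[OF fin _ \<open>y \<notin> W\<close>] by metis
  moreover have "0 \<le> embedding_slack G W r X"
    by (rule accommodatesD[OF room X])
  ultimately show thesis
    using X by (intro that[of X]) (auto simp: tight_def of_bool_def split: if_splits)
qed

text \<open>If no choice of \<open>y\<close> works, each \<open>y\<close> is blocked by a tight set. By submodularity the union
  of these sets is tight too; adding \<open>s\<close> to it contributes no new neighbours, so it makes the
  slack negative.\<close>

lemma expander_accommodates_extend:
  assumes G: "expander D m M G" and "1 \<le> m" and W: "finite W" "card W < M"
    and r: "\<And>x. r x \<le> int D" "0 < r s" and room: "accommodates m G W r" and s: "s \<in> uverts G"
  obtains y where "y \<in> neighbours G s - W" "accommodates m G (insert y W) (r(s := r s - 1))"
proof -
  have fin: "finite (uverts G)" using G by (simp add: expander_def)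
  note large = expander_embedding_slack_pos[OF G W, where r = r, OF r(1)]
  have "\<exists>y \<in> neighbours G s - W. accommodates m G (insert y W) (r(s := r s - 1))"
  proof (rule ccontr)
    let ?I = "neighbours G s - W"
    assume "\<not> ?thesis"
    then have "\<forall>y\<in>?I. \<exists>X. tight m G W r X \<and> y \<in> neighbourhood G X \<and> s \<notin> X"
      using tight_blocking_set[OF fin room] by blast
    then obtain X where X: "\<And>y. y \<in> ?I \<Longrightarrow> tight m G W r (X y)"
        "\<And>y. y \<in> ?I \<Longrightarrow> y \<in> neighbourhood G (X y)" "\<And>y. y \<in> ?I \<Longrightarrow> s \<notin> X y"
      by metis
    define U where "U = (\<Union>y\<in>?I. X y)"
    have "finite ?I" using fin by (simp add: neighbours_def)
    then have "tight m G W r U" unfolding U_def using X(1) by (intro tight_UN fin room large)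
    then have U: "U \<subseteq> uverts G" "card U \<le> m" "embedding_slack G W r U = 0" "finite U"
      using fin by (auto simp: tight_def intro: finite_subset)
    have "s \<notin> U" using X(3) by (auto simp: U_def)
    have "neighbourhood G (insert s U) - W = neighbourhood G U - W"
      using X(2) by (auto simp: U_def neighbourhood_def)
    then have "embedding_slack G W r (insert s U) < 0"
      using U(3,4) \<open>s \<notin> U\<close> r(2) by (simp add: embedding_slack_def)
    moreover have "insert s U \<subseteq> uverts G" "card (insert s U) \<le> 2 * m"
      using U s \<open>s \<notin> U\<close> \<open>1 \<le> m\<close> by auto
    ultimately show False
      using accommodatesD[OF room, of "insert s U"] large[of "insert s U"] by (cases "card (insert s U) \<le> m") auto
  qed
  then show thesis using that by blast
qed

text \<open>The number of neighbours of \<open>x\<close> in the part of the copy of \<open>T\<close> that is already embedded.\<close>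

definition image_degree :: "'b ugraph \<Rightarrow> ('b \<Rightarrow> 'a) \<Rightarrow> 'b set \<Rightarrow> 'a \<Rightarrow> nat" where
  "image_degree T f S x = card (neighbourhood T (S \<inter> f -` {x}) \<inter> S)"

definition adjacency_preserving :: "'b ugraph \<Rightarrow> 'a ugraph \<Rightarrow> ('b \<Rightarrow> 'a) \<Rightarrow> 'b set \<Rightarrow> bool" where
  "adjacency_preserving T G f S \<longleftrightarrow> (\<forall>u\<in>S. \<forall>v \<in> neighbours T u \<inter> S. f v \<in> neighbours G (f u))"

definition extendable_embedding ::
    "nat \<Rightarrow> nat \<Rightarrow> 'b ugraph \<Rightarrow> 'a ugraph \<Rightarrow> ('b \<Rightarrow> 'a) \<Rightarrow> 'b set \<Rightarrow> bool" where
  "extendable_embedding D m T G f S \<longleftrightarrow>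
     inj_on f S \<and> f ` S \<subseteq> uverts G \<and> adjacency_preserving T G f S \<and>
     accommodates m G (f ` S) (\<lambda>x. int D - int (image_degree T f S x))"

lemma image_degree_inj:
  assumes "inj_on f S" "v \<in> S"
  shows "image_degree T f S (f v) = card (neighbours T v \<inter> S)"
proof -
  have "S \<inter> f -` {f v} = {v}" using assms by (auto simp: inj_on_def)
  then show ?thesis by (simp add: image_degree_def neighbourhood_def)
qed

lemma image_degree_attach:
  assumes "finite S" "w \<notin> S" "s \<in> S" "w \<in> neighbours T s"
  shows "image_degree T f S x + of_bool (x = f s) \<le> image_degree T (f(w := y)) (insert w S) x"
proof -
  let ?old = "neighbourhood T (S \<inter> f -` {x}) \<inter> S"
  let ?new = "neighbourhood T (insert w S \<inter> f(w := y) -` {x}) \<inter> insert w S"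
  have "?old \<subseteq> ?new" using assms(2) by (auto simp: neighbourhood_def)
  moreover have "w \<in> ?new" if "x = f s" using assms that by (auto simp: neighbourhood_def)
  ultimately have "?old \<union> {v. v = w \<and> x = f s} \<subseteq> ?new" by blast
  then have "card (?old \<union> {v. v = w \<and> x = f s}) \<le> card ?new"
    using assms(1) by (intro card_mono) auto
  moreover have "card (?old \<union> {v. v = w \<and> x = f s}) = card ?old + of_bool (x = f s)"
    using assms(1,2) by simp
  ultimately show ?thesis by (simp add: image_degree_def)
qed

lemma extendable_embedding_singleton:
  assumes T: "simple_graph T" and G: "expander D m M G" and "x \<in> uverts G"
  shows "extendable_embedding D m T G (\<lambda>_. x) {v}"
proof -
  have fin: "finite (uverts G)" using G by (simp add: expander_def)
  have "0 \<le> embedding_slack G {x} (\<lambda>_. int D) X" if X: "X \<subseteq> uverts G" "card X \<le> m" for X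
  proof (cases "X = {}")
    case False
    then have "D * card X < card (neighbourhood G X)" using G X by (simp add: expander_def)
    then have "card X * D \<le> card (neighbourhood G X - {x})"
      using diff_card_le_card_Diff[of "{x}" "neighbourhood G X"] by (auto simp: mult.commute)
    then have "int (card X) * int D \<le> int (card (neighbourhood G X - {x}))"
      by (metis of_nat_le_iff of_nat_mult)
    then show ?thesis by (simp add: embedding_slack_def)
  qed (simp add: embedding_slack_def)
  then have "accommodates m G {x} (\<lambda>_. int D)" by (simp add: accommodates_def)
  then have "accommodates m G {x} (\<lambda>z. int D - int (image_degree T (\<lambda>_. x) {v} z))"
    by (rule accommodates_antimono) simp
  then show ?thesis
    using neighbours_simple_graphD[OF T, of v v] assms(3)
    by (auto simp: extendable_embedding_def adjacency_preserving_def)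
qed

lemma adjacency_preserving_attach:
  assumes T: "simple_graph T" and S: "S \<subseteq> uverts T" "w \<in> uverts T - S" "neighbours T w \<inter> S = {s}"
    and f: "adjacency_preserving T G f S"
    and y: "f s \<in> uverts G" "y \<in> neighbours G (f s)"
  shows "adjacency_preserving T G (f(w := y)) (insert w S)"
  unfolding adjacency_preserving_def
proof (intro ballI)
  fix u v assume uv: "u \<in> insert w S" "v \<in> neighbours T u \<inter> insert w S"
  have "u \<noteq> v" using neighbours_simple_graphD(3)[OF T] uv(2) by blast
  then consider (source) "u = w" "v \<in> S" | (target) "v = w" "u \<in> S" | (old) "u \<in> S" "v \<in> S"
    using uv by blast
  then show "(f(w := y)) v \<in> neighbours G ((f(w := y)) u)"
  proof cases
    case source
    then have "v = s" using uv S(3) by blast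
    with source y S(2) show ?thesis
      using neighbours_commute[of y G "f s"] by (auto simp: neighbours_def)
  next
    case target
    then have "u \<in> neighbours T w \<inter> S"
      using uv S neighbours_commute[of u T w] by blast
    with target y S(2,3) show ?thesis by auto
  next
    case old
    with uv S(2) f show ?thesis by (auto simp: adjacency_preserving_def)
  qed
qed

lemma extendable_embedding_attach:
  assumes T: "simple_graph T" "\<And>v. v \<in> uverts T \<Longrightarrow> card (neighbours T v) \<le> D"
    and G: "expander D m M G" "1 \<le> m"
    and S: "S \<subseteq> uverts T" "card S < M" "w \<in> uverts T - S" "neighbours T w \<inter> S = {s}"
    and f: "extendable_embedding D m T G f S"
  obtains y where "extendable_embedding D m T G (f(w := y)) (insert w S)"
proof -
  let ?demand = "\<lambda>f S x. int D - int (image_degree T f S x)"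
  have inj: "inj_on f S" and img: "f ` S \<subseteq> uverts G"
    and adj: "adjacency_preserving T G f S"
    and room: "accommodates m G (f ` S) (?demand f S)"
    using f by (auto simp: extendable_embedding_def)
  have fin: "finite (uverts T)" "finite S"
    using T(1) S(1) finite_subset by (auto simp: simple_graph_def)
  have s: "s \<in> S" "w \<in> neighbours T s"
    using S neighbours_commute[of s T w] by blast+
  have "card (neighbours T s \<inter> S) < card (neighbours T s)"
    using s S(3) fin by (intro psubset_card_mono) (auto simp: neighbours_def)
  also have "\<dots> \<le> D" using T(2) s S(1) by blast
  finally have unsaturated: "0 < ?demand f S (f s)"
    using image_degree_inj[OF inj s(1), of T] by simp
  have small: "card (f ` S) < M" using card_image[OF inj] S(2) by simp
  have fs: "f s \<in> uverts G" using img s(1) by blast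
  obtain y where y: "y \<in> neighbours G (f s) - f ` S"
    and room': "accommodates m G (insert y (f ` S)) ((?demand f S)(f s := ?demand f S (f s) - 1))"
    by (rule expander_accommodates_extend[OF G finite_imageI[OF fin(2)] small _ unsaturated room fs])
      simp
  let ?f = "f(w := y)"
  have img': "?f ` insert w S = insert y (f ` S)" using S(3) by auto
  have "?demand ?f (insert w S) x \<le> ((?demand f S)(f s := ?demand f S (f s) - 1)) x" for x
    using image_degree_attach[OF fin(2) _ s, of f x y] S(3) by auto
  then have "accommodates m G (?f ` insert w S) (?demand ?f (insert w S))"
    unfolding img' by (rule accommodates_antimono[OF room'])
  moreover have "inj_on ?f (insert w S)"
    using inj y S(3) by (auto simp: inj_on_def)
  moreover have "?f ` insert w S \<subseteq> uverts G"
    unfolding img' using img y by (auto simp: neighbours_def)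
  moreover have "adjacency_preserving T G ?f (insert w S)"
    using adjacency_preserving_attach[OF T(1) S(1,3,4) adj fs] y by blast
  ultimately have "extendable_embedding D m T G ?f (insert w S)"
    by (simp only: extendable_embedding_def)
  then show thesis by (rule that)
qed

theorem expander_contains_tree:
  assumes G: "expander D m M G" "1 \<le> m"
    and T: "ugraph_tree T" "card (uverts T) \<le> M" "ugraph_max_degree T \<le> D"
  shows "contains_copy G T"
proof -
  have simple: "simple_graph T" using T(1) by (simp add: ugraph_tree_def)
  have "\<exists>f. extendable_embedding D m T G f (uverts T)"
    using T(1)
  proof (induction rule: ugraph_tree_attach_induct)
    case (vertex r)
    obtain x where "x \<in> uverts G" using G(1) by (auto simp: expander_def)
    with simple G(1) show ?case by (blast intro: extendable_embedding_singleton)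
  next
    case (attach S s w)
    have "card S < M"
      using psubset_card_mono[OF _ attach(1)] simple T(2) by (auto simp: simple_graph_def)
    moreover have "card (neighbours T v) \<le> D" if "v \<in> uverts T" for v
      using card_neighbours_le_max_degree[OF simple that] T(3) by simp
    ultimately show ?case
      using attach extendable_embedding_attach[OF simple _ G] by (metis psubset_imp_subset)
  qed
  then obtain f where "inj_on f (uverts T)" "f ` uverts T \<subseteq> uverts G"
    "adjacency_preserving T G f (uverts T)"
    by (auto simp: extendable_embedding_def)
  then show ?thesis
    using neighbours_simple_graphD[OF simple]
    by (intro contains_copyI[OF simple]) (auto simp: adjacency_preserving_def)
qed

section \<open>Graphs without large bipartite holes\<close>

definition joined :: "nat \<Rightarrow> nat \<Rightarrow> 'a ugraph \<Rightarrow> bool" where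
  "joined a b G \<longleftrightarrow> (\<forall>A B. A \<subseteq> uverts G \<and> B \<subseteq> uverts G \<and> A \<inter> B = {} \<and> card A = a \<and> card B = b
     \<longrightarrow> neighbourhood G A \<inter> B \<noteq> {})"

definition nonexpanding :: "nat \<Rightarrow> nat \<Rightarrow> 'a ugraph \<Rightarrow> 'a set \<Rightarrow> bool" where
  "nonexpanding D k G B \<longleftrightarrow>
     B \<subseteq> uverts G \<and> card B \<le> k \<and> card (neighbourhood G B - B) \<le> D * card B"

lemma joined_card_neighbourhood:
  assumes J: "joined a b G" and fin: "finite (uverts G)" and X: "X \<subseteq> uverts G" "a \<le> card X"
  shows "card (uverts G) < card (neighbourhood G X - X) + card X + b"
proof (rule ccontr)
  let ?far = "uverts G - (neighbourhood G X \<union> X)"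
  assume "\<not> ?thesis"
  moreover have "card (neighbourhood G X \<union> X) = card (neighbourhood G X - X) + card X"
    using fin finite_subset[OF X(1) fin]
    by (subst card_Un_disjoint[symmetric]) (auto simp: finite_neighbourhood)
  moreover have "card ?far = card (uverts G) - card (neighbourhood G X \<union> X)"
    using fin X(1) neighbourhood_subset[of G X]
    by (intro card_Diff_subset) (auto intro: finite_subset)
  ultimately have "b \<le> card ?far" by linarith
  then obtain B where B: "B \<subseteq> ?far" "card B = b" by (meson obtain_subset_with_card_n)
  obtain A where A: "A \<subseteq> X" "card A = a" using X(2) by (meson obtain_subset_with_card_n)
  have "neighbourhood G A \<inter> B \<noteq> {}"
    using A B X(1) by (intro J[unfolded joined_def, rule_format]) auto
  then show False using neighbourhood_mono[OF A(1), of G] B(1) by blast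
qed

lemma joined_nonexpanding_card_less:
  assumes J: "joined m b G" and fin: "finite (uverts G)"
    and size: "(D + 1) * k + b \<le> card (uverts G)" and B: "nonexpanding D k G B"
  shows "card B < m"
proof (rule ccontr)
  assume "\<not> card B < m"
  then have "card (uverts G) < card (neighbourhood G B - B) + card B + b"
    using B by (intro joined_card_neighbourhood[OF J fin]) (auto simp: nonexpanding_def)
  also have "\<dots> \<le> (D + 1) * card B + b" using B by (simp add: nonexpanding_def)
  also have "\<dots> \<le> (D + 1) * k + b"
    using B by (intro add_mono mult_left_mono) (auto simp: nonexpanding_def)
  finally show False using size by simp
qed

lemma maximal_nonexpanding_imp_expansion:
  assumes fin: "finite (uverts G)" and B: "nonexpanding D k G B"
    and maximal: "\<And>B'. nonexpanding D k G B' \<Longrightarrow> card B' \<le> card B"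
    and X: "X \<subseteq> uverts G - B" "X \<noteq> {}" "card B + card X \<le> k"
  shows "D * card X < card (neighbourhood G X - B)"
proof (rule ccontr)
  assume contr: "\<not> ?thesis"
  have finite: "finite B" "finite X"
    using B X fin by (auto simp: nonexpanding_def intro: finite_subset)
  then have card: "card (B \<union> X) = card B + card X"
    using X by (intro card_Un_disjoint) auto
  have "card (neighbourhood G (B \<union> X) - (B \<union> X))
      \<le> card ((neighbourhood G B - B) \<union> (neighbourhood G X - B))"
    using fin by (intro card_mono) (auto simp: neighbourhood_Un finite_neighbourhood)
  also have "\<dots> \<le> card (neighbourhood G B - B) + card (neighbourhood G X - B)"
    by (rule card_Un_le)
  also have "\<dots> \<le> D * card (B \<union> X)"
    using B contr by (simp add: nonexpanding_def card algebra_simps)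
  finally have "nonexpanding D k G (B \<union> X)"
    using B X card by (auto simp: nonexpanding_def)
  then have "card (B \<union> X) \<le> card B" by (rule maximal)
  then show False using card X(2) finite(2) by simp
qed

lemma joined_card_neighbourhood_Diff:
  assumes J: "joined m b G" and fin: "finite (uverts G)" and B: "B \<subseteq> uverts G" "card B \<le> m"
    and X: "X \<subseteq> uverts G" "m \<le> card X" "card X \<le> k"
    and size: "(D + 1) * k + m + b + M \<le> card (uverts G)"
  shows "D * card X + M \<le> card (neighbourhood G X - B)"
proof -
  have "card (neighbourhood G X - X) \<le> card ((neighbourhood G X - B) \<union> B)"
    using fin B(1) by (intro card_mono) (auto simp: finite_neighbourhood intro: finite_subset)
  also have "\<dots> \<le> card (neighbourhood G X - B) + m"
    using card_Un_le[of "neighbourhood G X - B" B] B(2) by linarith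
  finally have "card (uverts G) < card (neighbourhood G X - B) + m + card X + b"
    using joined_card_neighbourhood[OF J fin X(1,2)] by linarith
  moreover have "(D + 1) * card X \<le> (D + 1) * k"
    using X(3) by (rule mult_left_mono) simp
  ultimately show ?thesis using size by simp
qed

text \<open>A maximum set \<open>B\<close> that does not expand is deleted: if a set \<open>X\<close> failed to expand in the rest,
  then \<open>B \<union> X\<close> would be a larger set that does not expand.\<close>

lemma joined_imp_expander:
  assumes J: "joined m b G" and fin: "finite (uverts G)"
    and size: "(2 * D + 3) * m + b + M \<le> card (uverts G)"
  obtains U where "U \<subseteq> uverts G" "expander D m M (induced_subgraph G U)"
proof -
  have size': "(D + 1) * (2 * m) + m + b + M \<le> card (uverts G)"
    using size by (simp add: algebra_simps)
  let ?bad = "nonexpanding D (2 * m) G"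
  have "?bad {}" by (simp add: nonexpanding_def neighbourhood_def)
  then obtain B where B: "?bad B" and maximal: "\<And>B'. ?bad B' \<Longrightarrow> card B' \<le> card B"
    using ex_has_greatest_nat[of ?bad "{}" card "Suc (2 * m)"] by (auto simp: nonexpanding_def)
  have "B \<subseteq> uverts G" using B by (simp add: nonexpanding_def)
  have "card B < m" using size' by (intro joined_nonexpanding_card_less[OF J fin _ B]) simp
  let ?U = "uverts G - B"
  have nbhd: "neighbourhood (induced_subgraph G ?U) X = neighbourhood G X - B" if "X \<subseteq> ?U" for X
    using neighbourhood_subset[of G X] by (auto simp: neighbourhood_induced_subgraph[OF that])
  have "expander D m M (induced_subgraph G ?U)"
    unfolding expander_def uverts_induced_subgraph
  proof (intro conjI allI impI; (elim conjE)?)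
    show "?U \<noteq> {}"
      using \<open>card B < m\<close> size' \<open>B \<subseteq> uverts G\<close> by auto
    show "D * card X < card (neighbourhood (induced_subgraph G ?U) X)"
      if "X \<subseteq> ?U" "X \<noteq> {}" "card X \<le> m" for X
      using maximal_nonexpanding_imp_expansion[OF fin B maximal that(1,2)] that \<open>card B < m\<close>
      by (simp add: nbhd)
    show "D * card X + M \<le> card (neighbourhood (induced_subgraph G ?U) X)"
      if "X \<subseteq> ?U" "m < card X" "card X \<le> 2 * m" for X
      unfolding nbhd[OF that(1)] using that \<open>card B < m\<close> \<open>B \<subseteq> uverts G\<close>
      by (intro joined_card_neighbourhood_Diff[OF J fin _ _ _ _ _ size']) auto
  qed (use fin in simp)
  then show thesis by (rule that[OF Diff_subset])
qed

theorem joined_contains_tree: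
  assumes "joined m b G" "finite (uverts G)" "1 \<le> m" "(2 * D + 3) * m + b + M \<le> card (uverts G)"
    and "ugraph_tree T" "card (uverts T) \<le> M" "ugraph_max_degree T \<le> D"
  shows "contains_copy G T"
proof -
  obtain U where U: "U \<subseteq> uverts G" "expander D m M (induced_subgraph G U)"
    using joined_imp_expander[OF assms(1,2,4)] by blast
  have "contains_copy (induced_subgraph G U) T"
    by (rule expander_contains_tree[OF U(2) assms(3,5-7)])
  then show ?thesis
    by (rule contains_copy_mono) (use U(1) in \<open>simp_all add: uedges_induced_subgraph\<close>)
qed

section \<open>The random graph\<close>

lemma prob_Pi_pmf_bernoulli_all_False:
  assumes "finite I" "F \<subseteq> I" "0 \<le> p" "p \<le> 1"
  shows "measure_pmf.prob (Pi_pmf I False (\<lambda>_. bernoulli_pmf p)) {X. \<forall>e\<in>F. \<not> X e} = (1 - p) ^ card F"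
proof -
  have "{X. \<forall>e\<in>F. \<not> X e} = Pi I (\<lambda>e. if e \<in> F then {False} else UNIV)"
    using assms(2) by (auto simp: Pi_iff split: if_splits)
  then have "measure_pmf.prob (Pi_pmf I False (\<lambda>_. bernoulli_pmf p)) {X. \<forall>e\<in>F. \<not> X e}
      = (\<Prod>e\<in>I. if e \<in> F then 1 - p else 1)"
    using assms by (simp add: measure_Pi_pmf_Pi) (auto intro!: prod.cong simp: measure_pmf_single)
  also have "\<dots> = (1 - p) ^ card F"
    using assms by (simp add: prod.If_cases Int_absorb1)
  finally show ?thesis .
qed

lemma prob_gnp_no_edge_between:
  assumes "0 \<le> p" "p \<le> 1" and AB: "A \<subseteq> {..<n}" "B \<subseteq> {..<n}" "A \<inter> B = {}"
  shows "measure_pmf.prob (gnp n p) {G. neighbourhood G A \<inter> B = {}} = (1 - p) ^ (card A * card B)"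
proof -
  let ?I = "nsets {..<n} 2"
  let ?F = "(\<lambda>(x, y). {x, y}) ` (A \<times> B)"
  have "?F \<subseteq> ?I" using AB by auto
  have "neighbourhood ({..<n}, {e \<in> ?I. X e}) A \<inter> B = {} \<longleftrightarrow> (\<forall>e\<in>?F. \<not> X e)" for X
    using AB(2) \<open>?F \<subseteq> ?I\<close> by (force simp: neighbourhood_def neighbours_def)
  then have "measure_pmf.prob (gnp n p) {G. neighbourhood G A \<inter> B = {}}
      = measure_pmf.prob (Pi_pmf ?I False (\<lambda>_. bernoulli_pmf p)) {X. \<forall>e\<in>?F. \<not> X e}"
    by (simp add: gnp_def vimage_def)
  also have "\<dots> = (1 - p) ^ card ?F"
    using assms(1,2) \<open>?F \<subseteq> ?I\<close>
    by (intro prob_Pi_pmf_bernoulli_all_False) (simp_all add: finite_imp_finite_nsets)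
  also have "inj_on (\<lambda>(x, y). {x, y}) (A \<times> B)"
    using AB(3) by (auto simp: inj_on_def doubleton_eq_iff)
  then have "card ?F = card A * card B" by (simp add: card_image card_cartesian_product)
  finally show ?thesis .
qed

lemma prob_gnp_not_joined_le:
  assumes "0 \<le> p" "p \<le> 1"
  shows "measure_pmf.prob (gnp n p) {G. \<not> joined a b G}
           \<le> real (n choose a) * real (n choose b) * (1 - p) ^ (a * b)"
proof -
  let ?prob = "measure_pmf.prob (gnp n p)"
  let ?all = "nsets {..<n} a \<times> nsets {..<n} b"
  define pairs where "pairs = {(A, B) \<in> ?all. A \<inter> B = {}}"
  have finite: "finite ?all" by (simp add: finite_imp_finite_nsets)
  have pairs: "pairs \<subseteq> ?all" by (auto simp: pairs_def)
  have "uverts G = {..<n}" if "G \<in> set_pmf (gnp n p)" for G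
    using that by (auto simp: gnp_def)
  then have "?prob {G. \<not> joined a b G} \<le> ?prob (\<Union>(A, B)\<in>pairs. {G. neighbourhood G A \<inter> B = {}})"
    by (intro measure_pmf.finite_measure_mono_AE)
      (auto simp: AE_measure_pmf_iff joined_def pairs_def nsets_def intro: finite_subset)
  also have "\<dots> \<le> (\<Sum>(A, B)\<in>pairs. ?prob {G. neighbourhood G A \<inter> B = {}})"
    unfolding case_prod_unfold using finite_subset[OF pairs finite]
    by (intro measure_pmf.finite_measure_subadditive_finite) auto
  also have "\<dots> = (\<Sum>(A, B)\<in>pairs. (1 - p) ^ (a * b))"
    using assms by (intro sum.cong refl)
      (auto simp: pairs_def nsets_def prob_gnp_no_edge_between)
  also have "\<dots> = real (card pairs) * (1 - p) ^ (a * b)" by (simp add: case_prod_unfold)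
  also have "\<dots> \<le> real ((n choose a) * (n choose b)) * (1 - p) ^ (a * b)"
    using card_mono[OF finite pairs] assms
    by (intro mult_right_mono of_nat_mono) (auto simp: card_cartesian_product)
  finally show ?thesis by simp
qed

definition entropy_bound :: "real \<Rightarrow> real" where
  "entropy_bound x = x * (1 - ln x)"

lemma binomial_le_exp_entropy_bound:
  fixes x :: real
  assumes "0 < x" "x \<le> 1" "real k \<le> x * real n"
  shows "real (n choose k) \<le> exp (entropy_bound x * real n)"
proof -
  have "real k \<le> real n" using assms mult_right_mono[of x 1 "real n"] by simp
  then have "real (n choose k) * x ^ k * 1 ^ (n - k) \<le> (\<Sum>i\<le>n. real (n choose i) * x ^ i * 1 ^ (n - i))"
    using assms by (intro member_le_sum) auto
  also have "\<dots> = (x + 1) ^ n" by (rule binomial_ring[symmetric])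
  also have "\<dots> \<le> exp x ^ n"
    using assms exp_ge_add_one_self[of x] by (intro power_mono) (auto simp: add.commute)
  also have "\<dots> = exp (x * real n)" by (simp add: exp_of_nat_mult[symmetric] mult.commute)
  finally have "real (n choose k) * x ^ k \<le> exp (x * real n)" by simp
  moreover have "exp (x * real n * ln x) \<le> x ^ k"
  proof -
    have "exp (x * real n * ln x) \<le> exp (real k * ln x)"
      using assms by (simp add: mult_right_mono_neg)
    also have "\<dots> = x ^ k" using assms by (simp add: exp_of_nat_mult)
    finally show ?thesis .
  qed
  ultimately have "real (n choose k) * exp (x * real n * ln x) \<le> exp (x * real n)"
    by (meson mult_left_mono of_nat_0_le_iff order_trans)
  then have "real (n choose k) \<le> exp (x * real n) / exp (x * real n * ln x)"
    by (simp add: field_simps)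
  also have "\<dots> = exp (entropy_bound x * real n)"
    by (simp add: entropy_bound_def exp_diff[symmetric] algebra_simps)
  finally show ?thesis .
qed

lemma one_minus_power_le_exp:
  fixes x :: real
  assumes "x \<le> 1"
  shows "(1 - x) ^ k \<le> exp (- x * real k)"
proof -
  have "(1 - x) ^ k \<le> exp (- x) ^ k"
    using assms exp_ge_add_one_self[of "- x"] by (intro power_mono) auto
  also have "\<dots> = exp (- x * real k)" by (simp add: exp_of_nat_mult[symmetric] mult.commute)
  finally show ?thesis .
qed

lemma floor_mult_floor_ge:
  fixes x y :: real
  assumes "1 \<le> x" "0 \<le> y"
  shows "x * y - (x + y) \<le> real (nat \<lfloor>x\<rfloor> * nat \<lfloor>y\<rfloor>)"
proof -
  have "(x - 1) * (y - 1) \<le> (x - 1) * real (nat \<lfloor>y\<rfloor>)"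
    using assms(1) by (intro mult_left_mono) linarith+
  also have "\<dots> \<le> real (nat \<lfloor>x\<rfloor>) * real (nat \<lfloor>y\<rfloor>)"
    by (intro mult_right_mono) linarith+
  finally show ?thesis by (simp add: algebra_simps)
qed

lemma prob_gnp_not_joined_le_exp:
  fixes \<alpha> \<beta> c :: real
  assumes \<alpha>: "0 < \<alpha>" "\<alpha> \<le> 1" and \<beta>: "0 < \<beta>" "\<beta> \<le> 1" and c: "0 < c" and n: "c \<le> real n" "1 \<le> \<alpha> * real n"
  shows "measure_pmf.prob (gnp n (c / real n)) {G. \<not> joined (nat \<lfloor>\<alpha> * real n\<rfloor>) (nat \<lfloor>\<beta> * real n\<rfloor>) G}
           \<le> exp (c * (\<alpha> + \<beta>) - (c * \<alpha> * \<beta> - (entropy_bound \<alpha> + entropy_bound \<beta>)) * real n)"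
proof -
  let ?a = "nat \<lfloor>\<alpha> * real n\<rfloor>" and ?b = "nat \<lfloor>\<beta> * real n\<rfloor>" and ?p = "c / real n"
  have n0: "0 < real n" using n c by linarith
  have p: "0 \<le> ?p" "?p \<le> 1" using n c n0 by auto
  have "?p * (\<alpha> * real n * (\<beta> * real n) - (\<alpha> * real n + \<beta> * real n)) \<le> ?p * real (?a * ?b)"
    using p(1) n(2) \<beta> by (intro mult_left_mono floor_mult_floor_ge) auto
  moreover have "?p * (\<alpha> * real n * (\<beta> * real n) - (\<alpha> * real n + \<beta> * real n))
      = c * \<alpha> * \<beta> * real n - c * (\<alpha> + \<beta>)"
    using n0 by (simp add: field_simps)
  ultimately have "- ?p * real (?a * ?b) \<le> c * (\<alpha> + \<beta>) - c * \<alpha> * \<beta> * real n"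
    unfolding mult_minus_left by linarith
  then have "(1 - ?p) ^ (?a * ?b) \<le> exp (c * (\<alpha> + \<beta>) - c * \<alpha> * \<beta> * real n)"
    using one_minus_power_le_exp[OF p(2), of "?a * ?b"] by (meson exp_le_cancel_iff order.trans)
  then have "real (n choose ?a) * real (n choose ?b) * (1 - ?p) ^ (?a * ?b)
      \<le> exp (entropy_bound \<alpha> * real n) * exp (entropy_bound \<beta> * real n)
         * exp (c * (\<alpha> + \<beta>) - c * \<alpha> * \<beta> * real n)"
    using p \<alpha> \<beta> by (intro mult_mono binomial_le_exp_entropy_bound) (auto intro: of_nat_floor)
  also have "\<dots> = exp (c * (\<alpha> + \<beta>) - (c * \<alpha> * \<beta> - (entropy_bound \<alpha> + entropy_bound \<beta>)) * real n)"
    by (simp add: exp_add[symmetric] algebra_simps)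
  finally show ?thesis
    using prob_gnp_not_joined_le[OF p, of n ?a ?b] by linarith
qed

theorem prob_gnp_joined_tendsto_1:
  fixes \<alpha> \<beta> c :: real
  assumes \<alpha>: "0 < \<alpha>" "\<alpha> \<le> 1" and \<beta>: "0 < \<beta>" "\<beta> \<le> 1" and c: "0 < c"
    and gap: "entropy_bound \<alpha> + entropy_bound \<beta> < c * \<alpha> * \<beta>"
  shows "(\<lambda>n. measure_pmf.prob (gnp n (c / real n))
           {G. joined (nat \<lfloor>\<alpha> * real n\<rfloor>) (nat \<lfloor>\<beta> * real n\<rfloor>) G}) \<longlonglongrightarrow> 1"
proof -
  let ?joined = "\<lambda>n. {G :: nat ugraph. joined (nat \<lfloor>\<alpha> * real n\<rfloor>) (nat \<lfloor>\<beta> * real n\<rfloor>) G}"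
  let ?prob = "\<lambda>n. measure_pmf.prob (gnp n (c / real n))"
  define \<delta> where "\<delta> = c * \<alpha> * \<beta> - (entropy_bound \<alpha> + entropy_bound \<beta>)"
  have "\<delta> > 0" using gap by (simp add: \<delta>_def)
  then have lim: "(\<lambda>n. exp (c * (\<alpha> + \<beta>) - \<delta> * real n)) \<longlonglongrightarrow> 0" by real_asymp
  have "\<forall>\<^sub>F n in sequentially. c \<le> real n \<and> 1 \<le> \<alpha> * real n"
    using \<alpha> by (intro eventually_conj; real_asymp)
  then have "\<forall>\<^sub>F n in sequentially. ?prob n (- ?joined n) \<le> exp (c * (\<alpha> + \<beta>) - \<delta> * real n)"
    using prob_gnp_not_joined_le_exp[OF \<alpha> \<beta> c]
    by (auto elim!: eventually_mono simp: \<delta>_def Collect_neg_eq[symmetric])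
  then have "(\<lambda>n. ?prob n (- ?joined n)) \<longlonglongrightarrow> 0"
    by (intro tendsto_sandwich[OF _ _ tendsto_const lim]) simp_all
  then have "(\<lambda>n. 1 - ?prob n (- ?joined n)) \<longlonglongrightarrow> 1 - 0" by (intro tendsto_diff tendsto_const)
  moreover have "1 - ?prob n (- ?joined n) = ?prob n (?joined n)" for n
    using measure_pmf.prob_compl[of "?joined n" "gnp n (c / real n)"] by (simp add: Compl_eq_Diff_UNIV)
  ultimately show ?thesis by simp
qed

section \<open>The constants\<close>

lemma one_le_ln_four_exp_div:
  fixes x :: real
  assumes "0 < x" "x \<le> 1"
  shows "1 \<le> ln (4 * exp 1 / x)"
  using assms by (subst ln_ge_iff) (auto simp: field_simps)

lemma entropy_bound_tree_parameters_less:
  fixes \<Delta> :: nat and \<epsilon> c :: real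
  assumes \<Delta>: "\<Delta> \<ge> 2" and \<epsilon>: "0 < \<epsilon>" "\<epsilon> < 1/2"
    and c: "c \<ge> (30 * real \<Delta> / \<epsilon>) * ln (4 * exp 1 / \<epsilon>)"
  shows "entropy_bound (\<epsilon> / (7 * real \<Delta>)) + entropy_bound (\<epsilon> / 2) < c * (\<epsilon> / (7 * real \<Delta>)) * (\<epsilon> / 2)"
proof -
  define L where "L = ln (4 * exp 1 / \<epsilon>)"
  have L: "L = ln 4 + 1 - ln \<epsilon>" using \<epsilon> by (simp add: L_def ln_div ln_mult)
  have "L \<ge> 1" unfolding L_def using \<epsilon> by (intro one_le_ln_four_exp_div) auto
  have "ln (7 * real \<Delta>) = ln 4 + ln (7 / 4 * real \<Delta>)"
    using \<Delta> by (subst ln_mult_pos[symmetric]) auto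
  also have "\<dots> \<le> ln 4 + 7 / 4 * real \<Delta>"
    using \<Delta> ln_le_minus_one[of "7 / 4 * real \<Delta>"] by simp
  finally have "1 - ln (\<epsilon> / (7 * real \<Delta>)) \<le> L + 7 / 4 * real \<Delta>"
    using \<Delta> \<epsilon> by (simp add: L ln_div)
  then have "entropy_bound (\<epsilon> / (7 * real \<Delta>)) \<le> \<epsilon> / (7 * real \<Delta>) * (L + 7 / 4 * real \<Delta>)"
    unfolding entropy_bound_def using \<epsilon> by (intro mult_left_mono) auto
  also have "\<dots> = \<epsilon> * L * (1 / (7 * real \<Delta>)) + \<epsilon> / 4" using \<Delta> by (simp add: field_simps)
  also have "\<dots> \<le> \<epsilon> * L * (1 / 14) + \<epsilon> * L * (1 / 4)"
    using \<Delta> \<epsilon> \<open>L \<ge> 1\<close> by (intro add_mono mult_left_mono) (auto simp: field_simps)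
  finally have "entropy_bound (\<epsilon> / (7 * real \<Delta>)) \<le> \<epsilon> * L * (9 / 28)" by linarith
  moreover have "entropy_bound (\<epsilon> / 2) \<le> \<epsilon> * L * (1 / 2)"
  proof -
    have "ln (2 :: real) \<le> ln 4" by simp
    then have "1 - ln (\<epsilon> / 2) \<le> L" using \<epsilon> by (simp add: L ln_div)
    then have "\<epsilon> / 2 * (1 - ln (\<epsilon> / 2)) \<le> \<epsilon> / 2 * L" using \<epsilon> by (intro mult_left_mono) auto
    then show ?thesis by (simp add: entropy_bound_def)
  qed
  ultimately have "entropy_bound (\<epsilon> / (7 * real \<Delta>)) + entropy_bound (\<epsilon> / 2) \<le> \<epsilon> * L * (23 / 28)"
    by linarith
  also have "\<dots> < \<epsilon> * L * (15 / 7)" using \<epsilon> \<open>L \<ge> 1\<close> by simp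
  also have "\<dots> = (30 * real \<Delta> / \<epsilon> * L) * (\<epsilon> / (7 * real \<Delta>) * (\<epsilon> / 2))"
    using \<Delta> \<epsilon> by (simp add: field_simps)
  also have "\<dots> \<le> c * (\<epsilon> / (7 * real \<Delta>) * (\<epsilon> / 2))"
    using c \<epsilon> by (intro mult_right_mono) (auto simp: L_def)
  finally show ?thesis by (simp add: mult.assoc)
qed

lemma tree_parameters_fit:
  fixes \<Delta> n :: nat and \<epsilon> :: real
  assumes "\<Delta> \<ge> 2" "0 < \<epsilon>" "\<epsilon> \<le> 1"
  shows "(2 * \<Delta> + 3) * nat \<lfloor>\<epsilon> / (7 * real \<Delta>) * real n\<rfloor> + nat \<lfloor>\<epsilon> / 2 * real n\<rfloor>
           + nat \<lfloor>(1 - \<epsilon>) * real n\<rfloor> \<le> n"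
proof -
  define \<alpha> where "\<alpha> = \<epsilon> / (7 * real \<Delta>)"
  have "0 < \<alpha>" using assms by (simp add: \<alpha>_def)
  have "real ((2 * \<Delta> + 3) * nat \<lfloor>\<alpha> * real n\<rfloor> + nat \<lfloor>\<epsilon> / 2 * real n\<rfloor> + nat \<lfloor>(1 - \<epsilon>) * real n\<rfloor>)
      \<le> (2 * real \<Delta> + 3) * (\<alpha> * real n) + \<epsilon> / 2 * real n + (1 - \<epsilon>) * real n"
    unfolding of_nat_add of_nat_mult using assms \<open>0 < \<alpha>\<close>
    by (intro add_mono mult_mono of_nat_floor) auto
  also have "\<dots> = ((2 * real \<Delta> + 3) * \<alpha> + (1 - \<epsilon> / 2)) * real n" by (simp add: algebra_simps)
  also have "\<dots> \<le> 1 * real n"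
  proof (rule mult_right_mono)
    have "(2 * real \<Delta> + 3) * \<alpha> \<le> (7 / 2 * real \<Delta>) * \<alpha>"
      using assms \<open>0 < \<alpha>\<close> by (intro mult_right_mono) auto
    also have "\<dots> = \<epsilon> / 2" using assms by (simp add: \<alpha>_def)
    finally show "(2 * real \<Delta> + 3) * \<alpha> + (1 - \<epsilon> / 2) \<le> 1" by simp
  qed simp
  finally show ?thesis unfolding \<alpha>_def mult_1 of_nat_le_iff .
qed

lemma joined_gnp_contains_tree:
  fixes \<Delta> n :: nat and \<epsilon> p :: real
  assumes G: "G \<in> set_pmf (gnp n p)"
      "joined (nat \<lfloor>\<epsilon> / (7 * real \<Delta>) * real n\<rfloor>) (nat \<lfloor>\<epsilon> / 2 * real n\<rfloor>) G"
    and "\<Delta> \<ge> 2" "0 < \<epsilon>" "\<epsilon> \<le> 1" and n: "1 \<le> \<epsilon> / (7 * real \<Delta>) * real n"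
    and T: "ugraph_tree T" "real (card (uverts T)) \<le> (1 - \<epsilon>) * real n" "ugraph_max_degree T \<le> \<Delta>"
  shows "contains_copy G T"
proof (rule joined_contains_tree[OF G(2)])
  have uverts: "uverts G = {..<n}" using G(1) by (auto simp: gnp_def)
  show "finite (uverts G)" by (simp add: uverts)
  show "(2 * \<Delta> + 3) * nat \<lfloor>\<epsilon> / (7 * real \<Delta>) * real n\<rfloor> + nat \<lfloor>\<epsilon> / 2 * real n\<rfloor>
      + nat \<lfloor>(1 - \<epsilon>) * real n\<rfloor> \<le> card (uverts G)"
    using tree_parameters_fit[OF assms(3-5)] by (simp add: uverts)
  show "1 \<le> nat \<lfloor>\<epsilon> / (7 * real \<Delta>) * real n\<rfloor>" using n by (simp add: le_nat_iff le_floor_iff)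
  show "card (uverts T) \<le> nat \<lfloor>(1 - \<epsilon>) * real n\<rfloor>" using T(2) by (rule le_nat_floor)
qed (use T in auto)

theorem theorem1p5:
  fixes \<Delta> :: nat and \<epsilon> c :: real
  assumes "\<Delta> \<ge> 2" and "0 < \<epsilon>" and "\<epsilon> < 1/2"
    and "c \<ge> (30 * real \<Delta> / \<epsilon>) * ln (4 * exp 1 / \<epsilon>)"
  shows "(\<lambda>n. measure_pmf.prob (gnp n (c / real n))
            {G. \<forall>T :: nat ugraph. ugraph_tree T \<and> real (card (uverts T)) \<le> (1 - \<epsilon>) * real n \<and>
                  ugraph_max_degree T \<le> \<Delta> \<longrightarrow> contains_copy G T}) \<longlonglongrightarrow> 1"
    (is "(\<lambda>n. measure_pmf.prob (?G n) (?universal n)) \<longlonglongrightarrow> 1")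
proof -
  let ?\<alpha> = "\<epsilon> / (7 * real \<Delta>)" and ?\<beta> = "\<epsilon> / 2"
  let ?joined = "\<lambda>n. {G :: nat ugraph. joined (nat \<lfloor>?\<alpha> * real n\<rfloor>) (nat \<lfloor>?\<beta> * real n\<rfloor>) G}"
  have \<alpha>: "0 < ?\<alpha>" "?\<alpha> \<le> 1" and \<beta>: "0 < ?\<beta>" "?\<beta> \<le> 1"
    using assms(1-3) by (auto simp: field_simps)
  have "0 < (30 * real \<Delta> / \<epsilon>) * ln (4 * exp 1 / \<epsilon>)"
    using assms(1-3) one_le_ln_four_exp_div[of \<epsilon>] by (intro mult_pos_pos divide_pos_pos) linarith+
  then have "0 < c" using assms(4) by linarith
  then have lim: "(\<lambda>n. measure_pmf.prob (?G n) (?joined n)) \<longlonglongrightarrow> 1"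
    by (intro prob_gnp_joined_tendsto_1 \<alpha> \<beta> entropy_bound_tree_parameters_less assms)
  have "\<forall>\<^sub>F n in sequentially. 1 \<le> ?\<alpha> * real n" using \<alpha>(1) by real_asymp
  then have "\<forall>\<^sub>F n in sequentially. measure_pmf.prob (?G n) (?joined n) \<le> measure_pmf.prob (?G n) (?universal n)"
  proof (rule eventually_mono)
    fix n assume "1 \<le> ?\<alpha> * real n"
    then show "measure_pmf.prob (?G n) (?joined n) \<le> measure_pmf.prob (?G n) (?universal n)"
      using assms(1-3) by (intro measure_pmf.finite_measure_mono_AE)
        (auto simp: AE_measure_pmf_iff intro: joined_gnp_contains_tree)
  qed
  then show ?thesis
    by (rule tendsto_sandwich[OF _ _ lim tendsto_const]) simp
qed

end
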